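(* Let $n\geq 3$ and let $D_n=\langle a,b\mid a^n=b^2=(ab)^2=e\rangle$ be the dihedral group of order $2n$. Then $OD(D_n)$ is the star graph $S_{2n}$ if and only if $n$ is prime.
   Context: For a finite group $G$, the order divisor graph $OD(G)$ is the simple undirected graph with vertex set $G$ in which two distinct vertices $a,b$ are adjacent if and only if $o(a)\neq o(b)$ and either $o(a)\mid o(b)$ or $o(b)\mid o(a)$. $S_m$ denotes the star graph on $m$ vertices: a tree with one vertex of degree $m-1$ and all other vertices of degree $1$. *)

theory Defs
  imports
    "HOL-Algebra.Multiplicative_Group"
    "HOL-Computational_Algebra.Primes"
    "Graph_Theory.Digraph_Component"
begin

section \<open>Groups given by generators and relators\<close>

text \<open>
  A word over the generators \<open>'g\<close> is a list of letters; \<open>(g, True)\<close> stands for \<open>g\<close> and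
  \<open>(g, False)\<close> for the formal inverse of \<open>g\<close>.
\<close>

type_synonym 'g word = "('g \<times> bool) list"

text \<open>
  The least congruence on words that cancels inverse pairs and makes every relator trivial.
  Its classes are the elements of the free group on \<open>'g\<close> modulo the normal closure of \<open>R\<close>.
\<close>

inductive_set pres_rel :: "'g word set \<Rightarrow> 'g word rel" for R :: "'g word set" where
  refl: "(w, w) \<in> pres_rel R"
| sym: "(v, w) \<in> pres_rel R \<Longrightarrow> (w, v) \<in> pres_rel R"
| trans: "(u, v) \<in> pres_rel R \<Longrightarrow> (v, w) \<in> pres_rel R \<Longrightarrow> (u, w) \<in> pres_rel R"
| cancel: "(u @ [(g, s), (g, \<not> s)] @ v, u @ v) \<in> pres_rel R"
| relator: "r \<in> R \<Longrightarrow> (u @ r @ v, u @ v) \<in> pres_rel R"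

definition presented_group :: "'g word set \<Rightarrow> 'g word set monoid" where
  "presented_group R =
    \<lparr> partial_object.carrier = UNIV // pres_rel R,
      monoid.mult = (\<lambda>X Y. \<Union>x\<in>X. \<Union>y\<in>Y. pres_rel R `` {x @ y}),
      monoid.one = pres_rel R `` {[]} \<rparr>"

lemma equiv_pres_rel: "equiv UNIV (pres_rel R)"
  by (intro equivI subset_UNIV refl_onI symI transI) (auto intro: pres_rel.intros)

lemma pres_rel_context:
  "(x, y) \<in> pres_rel R \<Longrightarrow> (p @ x @ q, p @ y @ q) \<in> pres_rel R"
proof (induction rule: pres_rel.induct)
  case (cancel u g s v)
  show ?case using pres_rel.cancel[of "p @ u" g s "v @ q" R] by simp
next
  case (relator r u v)
  then show ?case using pres_rel.relator[of r R "p @ u" "v @ q"] by simp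
qed (blast intro: pres_rel.intros)+

lemma pres_rel_append:
  assumes "(x, x') \<in> pres_rel R" "(y, y') \<in> pres_rel R"
  shows "(x @ y, x' @ y') \<in> pres_rel R"
  using pres_rel_context[OF assms(1), of "[]" y] pres_rel_context[OF assms(2), of x' "[]"]
  by (auto intro: pres_rel.trans)

lemma mult_presented_group:
  "pres_rel R `` {x} \<otimes>\<^bsub>presented_group R\<^esub> pres_rel R `` {y} = pres_rel R `` {x @ y}"
proof -
  have "(\<lambda>x y. pres_rel R `` {x @ y}) respects2 pres_rel R"
    by (intro congruent2I' equiv_class_eq[OF equiv_pres_rel] pres_rel_append)
  then show ?thesis
    by (simp add: presented_group_def UN_equiv_class2[OF equiv_pres_rel equiv_pres_rel])
qed

lemma pres_rel_left_inverse:
  "(rev (map (apsnd Not) w) @ w, []) \<in> pres_rel R"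
proof (induction w)
  case Nil
  show ?case by (simp add: pres_rel.refl)
next
  case (Cons l w)
  obtain g s where l: "l = (g, s)" by (cases l)
  show ?case
    using pres_rel.cancel[of "rev (map (apsnd Not) w)" g "\<not> s" w R] Cons.IH
    by (auto simp: l intro: pres_rel.trans)
qed

lemma group_presented_group: "group (presented_group R)"
proof (rule groupI)
  show "\<exists>Y\<in>carrier (presented_group R). Y \<otimes>\<^bsub>presented_group R\<^esub> X = \<one>\<^bsub>presented_group R\<^esub>"
    if "X \<in> carrier (presented_group R)" for X
  proof -
    from that obtain x where x: "X = pres_rel R `` {x}"
      by (auto simp: presented_group_def quotient_def)
    let ?Y = "pres_rel R `` {rev (map (apsnd Not) x)}"
    have "?Y \<otimes>\<^bsub>presented_group R\<^esub> X = \<one>\<^bsub>presented_group R\<^esub>"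
      unfolding x mult_presented_group
      by (simp add: presented_group_def equiv_class_eq[OF equiv_pres_rel pres_rel_left_inverse])
    moreover have "?Y \<in> carrier (presented_group R)"
      by (simp add: presented_group_def quotientI)
    ultimately show ?thesis by blast
  qed
next
  show "\<one>\<^bsub>presented_group R\<^esub> \<in> carrier (presented_group R)"
    by (simp add: presented_group_def quotientI)
next
  fix X Y assume "X \<in> carrier (presented_group R)" "Y \<in> carrier (presented_group R)"
  then obtain x y where "X = pres_rel R `` {x}" "Y = pres_rel R `` {y}"
    by (auto simp: presented_group_def quotient_def)
  then have "X \<otimes>\<^bsub>presented_group R\<^esub> Y = pres_rel R `` {x @ y}"
    by (simp add: mult_presented_group)
  then show "X \<otimes>\<^bsub>presented_group R\<^esub> Y \<in> carrier (presented_group R)"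
    by (simp add: presented_group_def quotientI)
next
  fix X Y Z
  assume "X \<in> carrier (presented_group R)" "Y \<in> carrier (presented_group R)"
    "Z \<in> carrier (presented_group R)"
  then obtain x y z where "X = pres_rel R `` {x}" "Y = pres_rel R `` {y}" "Z = pres_rel R `` {z}"
    by (auto simp: presented_group_def quotient_def)
  then show "X \<otimes>\<^bsub>presented_group R\<^esub> Y \<otimes>\<^bsub>presented_group R\<^esub> Z =
      X \<otimes>\<^bsub>presented_group R\<^esub> (Y \<otimes>\<^bsub>presented_group R\<^esub> Z)"
    by (simp add: mult_presented_group)
next
  fix X assume "X \<in> carrier (presented_group R)"
  then obtain x where x: "X = pres_rel R `` {x}"
    by (auto simp: presented_group_def quotient_def)
  have one: "\<one>\<^bsub>presented_group R\<^esub> = pres_rel R `` {[]}"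
    by (simp add: presented_group_def)
  show "\<one>\<^bsub>presented_group R\<^esub> \<otimes>\<^bsub>presented_group R\<^esub> X = X"
    unfolding x one mult_presented_group by simp
qed


section \<open>The dihedral group\<close>

datatype dihedral_gen = Gen_a | Gen_b

definition dihedral_group :: "nat \<Rightarrow> dihedral_gen word set monoid" where
  "dihedral_group n =
    (let a = (Gen_a, True); b = (Gen_b, True)
     in presented_group {replicate n a, [b, b], [a, b, a, b]})"

lemma group_dihedral_group: "group (dihedral_group n)"
  by (simp add: dihedral_group_def Let_def group_presented_group)


section \<open>The order divisor graph and star graphs\<close>

text \<open>Undirected graphs are symmetric digraphs: an edge is a pair of opposite arcs.\<close>

definition order_divisor_graph :: "('a, 'm) monoid_scheme \<Rightarrow> 'a pair_pre_digraph" where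
  "order_divisor_graph G =
    \<lparr> pverts = carrier G,
      parcs = {(x, y). x \<in> carrier G \<and> y \<in> carrier G \<and> x \<noteq> y \<and>
        group.ord G x \<noteq> group.ord G y \<and>
        (group.ord G x dvd group.ord G y \<or> group.ord G y dvd group.ord G x)} \<rparr>"

text \<open>
  \<^const>\<open>Digraph_Component.tree\<close> excludes directed cycles, so it fails for every symmetric digraph
  with an edge, where each edge gives a cycle \<open>u, v, u\<close> of length 2. In a simple graph the
  undirected cycles are the cycles of length at least 3.
\<close>

definition undirected_tree :: "('a, 'b) pre_digraph \<Rightarrow> bool" where
  "undirected_tree G \<longleftrightarrow> graph G \<and> Digraph_Component.connected G \<and>
    \<not> (\<exists>p. pre_digraph.cycle G p \<and> 3 \<le> length p)"

text \<open>In a symmetric digraph \<^const>\<open>out_degree\<close> is the degree of the undirected graph.\<close>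

definition star_graph :: "nat \<Rightarrow> ('a, 'b) pre_digraph \<Rightarrow> bool" where
  "star_graph m G \<longleftrightarrow> undirected_tree G \<and> card (verts G) = m \<and>
    (\<exists>c\<in>verts G. out_degree G c = m - 1 \<and> (\<forall>v\<in>verts G - {c}. out_degree G v = 1))"

end

theory Submission
  imports Defs
begin

text \<open>
  The identity is adjacent to every other vertex of the order divisor graph of a finite group. If all
  other elements have prime order there are no further edges. If \<open>x\<close> has order \<open>m > 1\<close> and a
  prime \<open>p\<close> divides \<open>m\<close> properly, then the identity, \<open>x\<close> and a power of \<open>x\<close> of order \<open>p\<close>
  form a triangle. So the graph is a star iff all nonidentity elements have prime order. In the
  dihedral group, \<open>a\<close> has order \<open>n\<close> and every order divides \<open>n\<close> or 2.
\<close>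

section \<open>Order divisor graphs that are stars\<close>

lemma pair_graph_order_divisor_graph:
  assumes "finite (carrier G)"
  shows "pair_graph (order_divisor_graph G)"
proof
  have "parcs (order_divisor_graph G) \<subseteq> carrier G \<times> carrier G"
    by (auto simp: order_divisor_graph_def)
  then show "finite (parcs (order_divisor_graph G))"
    using assms by (auto intro: finite_subset)
qed (use assms in \<open>auto simp: order_divisor_graph_def symmetric_def arcs_ends_conv sym_def\<close>)

lemma pcas_end_in_pawalk_verts: "pcas u p v \<Longrightarrow> v \<in> set (pawalk_verts u p)"
  by (induction p arbitrary: u) auto

context group
begin

lemma star_graph_order_divisor_graph_if_ord_prime:
  assumes fin: "finite (carrier G)"
    and ord: "\<And>x. x \<in> carrier G \<Longrightarrow> x \<noteq> \<one> \<Longrightarrow> Factorial_Ring.prime (ord x)"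
  shows "star_graph (order G) (with_proj (order_divisor_graph G))"
proof -
  let ?O = "order_divisor_graph G"
  interpret pair_graph ?O
    using fin by (rule pair_graph_order_divisor_graph)
  have verts: "pverts ?O = carrier G"
    by (simp add: order_divisor_graph_def)
  have ord_one_iff: "ord x = Suc 0 \<longleftrightarrow> x = \<one>" if "x \<in> carrier G" for x
    using ord_eq_1[OF that] by simp
  have arc_iff: "(x, y) \<in> parcs ?O \<longleftrightarrow>
      x \<in> carrier G \<and> y \<in> carrier G \<and> x \<noteq> y \<and> (x = \<one> \<or> y = \<one>)" for x y
  \<comment> \<open>Distinct primes do not divide each other, so two nonidentity vertices are never
    adjacent. The identity alone has order 1, which divides every order.\<close>
  proof (cases "x \<in> carrier G \<and> y \<in> carrier G \<and> x \<noteq> \<one> \<and> y \<noteq> \<one>")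
    case True
    then show ?thesis
      using primes_dvd_imp_eq[OF ord[of x] ord[of y]] primes_dvd_imp_eq[OF ord[of y] ord[of x]]
      by (auto simp: order_divisor_graph_def)
  next
    case False
    then show ?thesis
      using ord_one_iff by (auto simp: order_divisor_graph_def) metis+
  qed
  have connected: "Digraph_Component.connected (with_proj ?O)"
    unfolding connected_def
  proof (rule strongly_connectedI)
    \<comment> \<open>\<open>connected\<close> means that the symmetric closure is strongly
      connected, so paths are sought there; each passes through the identity.\<close>
    let ?S = "with_proj (mk_symmetric (with_proj ?O))"
    have verts_S: "pverts (mk_symmetric (with_proj ?O)) = carrier G"
      by (simp add: mk_symmetric_def verts)
    show "verts ?S \<noteq> {}"
      using verts_S verts by auto
    interpret S: pair_wf_digraph "mk_symmetric (with_proj ?O)"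
      by (rule wf_digraph.wellformed_mk_symmetric) unfold_locales
    have reach: "x \<rightarrow>\<^sup>*\<^bsub>?S\<^esub> \<one> \<and> \<one> \<rightarrow>\<^sup>*\<^bsub>?S\<^esub> x" if "x \<in> carrier G" for x
    proof (cases "x = \<one>")
      case True
      then show ?thesis
        by (auto simp: verts)
    next
      case False
      then have "(x, \<one>) \<in> parcs ?O" "(\<one>, x) \<in> parcs ?O"
        using that by (auto simp: arc_iff)
      then have "(x, \<one>) \<in> parcs (mk_symmetric (with_proj ?O))"
        "(\<one>, x) \<in> parcs (mk_symmetric (with_proj ?O))"
        by (auto simp: mk_symmetric_def)
      then show ?thesis
        by (simp add: S.reachable_adjI)
    qed
    show "u \<rightarrow>\<^sup>*\<^bsub>?S\<^esub> v" if "u \<in> verts ?S" "v \<in> verts ?S" for u v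
    proof (rule S.reachable_trans)
      have "u \<in> carrier G" "v \<in> carrier G"
        using that verts_S by auto
      then show "u \<rightarrow>\<^sup>*\<^bsub>?S\<^esub> \<one>" "\<one> \<rightarrow>\<^sup>*\<^bsub>?S\<^esub> v"
        using reach by blast+
    qed
  qed
  have acyclic: "\<not> (\<exists>p. pre_digraph.cycle (with_proj ?O) p \<and> 3 \<le> length p)"
  proof
    assume "\<exists>p. pre_digraph.cycle (with_proj ?O) p \<and> 3 \<le> length p"
    then obtain p u where walk: "set p \<subseteq> parcs ?O" "pcas u p u"
      and distinct: "distinct (tl (pawalk_verts u p))" and len: "3 \<le> length p"
      by (auto simp: cycle_def awalk_def)
    from len obtain e1 e2 e3 q where "p = e1 # e2 # e3 # q"
      by (auto simp: numeral_3_eq_3 Suc_le_length_iff)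
    moreover obtain x y z where "e1 = (u, x)" "e2 = (x, y)" "e3 = (y, z)"
      using walk(2) calculation by (cases e1; cases e2; cases e3) auto
    ultimately have p: "p = (u, x) # (x, y) # (y, z) # q"
      by simp
    \<comment> \<open>Distinctness separates \<open>x\<close> from \<open>y\<close>, and both from
      \<open>z\<close> and \<open>u\<close>; here \<open>u = z\<close> may hold. Each of the three
      arcs contains the identity: if it is \<open>x\<close>, it misses the arc from \<open>y\<close>
      to \<open>z\<close>; otherwise it is both \<open>u\<close> and \<open>y\<close>. Both cases
      are impossible.\<close>
    have "u \<in> set (pawalk_verts z q)" "z \<in> set (pawalk_verts z q)"
      using walk(2) by (cases q; auto simp: p dest: pcas_end_in_pawalk_verts)+
    then show False
      using walk(1) distinct by (auto simp: p arc_iff)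
  qed
  have "out_arcs (with_proj ?O) \<one> = Pair \<one> ` (carrier G - {\<one>})"
    by (auto simp: out_arcs_def arc_iff)
  then have center: "out_degree (with_proj ?O) \<one> = order G - 1"
    by (simp add: out_degree_def card_image inj_on_def order_def card_Diff_singleton)
  have leaf: "out_degree (with_proj ?O) v = 1" if "v \<in> carrier G - {\<one>}" for v
  proof -
    have "out_arcs (with_proj ?O) v = {(v, \<one>)}"
      using that by (auto simp: out_arcs_def arc_iff)
    then show ?thesis
      by (simp add: out_degree_def)
  qed
  have "graph (with_proj ?O)"
    by unfold_locales
  with connected acyclic center leaf show ?thesis
    by (auto simp: star_graph_def undirected_tree_def verts order_def intro!: bexI[of _ \<one>])
qed

lemma ord_prime_if_undirected_tree_order_divisor_graph:
  assumes fin: "finite (carrier G)"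
    and tree: "undirected_tree (with_proj (order_divisor_graph G))"
    and x: "x \<in> carrier G" "x \<noteq> \<one>"
  shows "Factorial_Ring.prime (ord x)"
proof (rule ccontr)
  let ?O = "order_divisor_graph G"
  interpret pair_graph ?O
    using fin by (rule pair_graph_order_divisor_graph)
  assume not_prime: "\<not> Factorial_Ring.prime (ord x)"
  have ord_x: "ord x \<noteq> 1"
    using x ord_eq_1 by blast
  then obtain p where p: "Factorial_Ring.prime p" "p dvd ord x"
    using prime_factor_nat by blast
  then obtain k where k: "ord x = p * k"
    by blast
  \<comment> \<open>An order 0 would mean infinite order, which finiteness excludes.\<close>
  have "k \<noteq> 0"
    using ord_ge_1[OF fin x(1)] k by (metis mult_0_right not_one_le_zero)
  \<comment> \<open>Dividing the order \<open>p * k\<close> by \<open>k\<close> leaves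
    \<open>p\<close>, so this power is the third vertex of the triangle.\<close>
  define y where "y = x [^] k"
  have y: "y \<in> carrier G" "ord y = p"
    using x k p ord_pow[of x k] \<open>k \<noteq> 0\<close> by (auto simp: y_def)
  have "p \<noteq> 1" "p \<noteq> ord x"
    using p not_prime by auto
  moreover have "ord \<one> = 1"
    using ord_eq_1 by blast
  ultimately have arcs: "(\<one>, x) \<in> parcs ?O" "(x, y) \<in> parcs ?O" "(y, \<one>) \<in> parcs ?O"
    using x y p ord_x by (auto simp: order_divisor_graph_def)
  then have "\<one> \<noteq> x" "x \<noteq> y" "y \<noteq> \<one>" "\<one> \<in> pverts ?O"
    by (auto simp: order_divisor_graph_def)
  then have "cycle [(\<one>, x), (x, y), (y, \<one>)]"
    using arcs unfolding cycle_def awalk_def by (intro exI[of _ "\<one>"]) auto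
  moreover have "3 \<le> length [(\<one>, x), (x, y), (y, \<one>)]"
    by simp
  ultimately show False
    using tree unfolding undirected_tree_def by blast
qed

theorem star_graph_order_divisor_graph_iff:
  assumes "finite (carrier G)"
  shows "star_graph (order G) (with_proj (order_divisor_graph G)) \<longleftrightarrow>
    (\<forall>x\<in>carrier G - {\<one>}. Factorial_Ring.prime (ord x))"
  using assms star_graph_order_divisor_graph_if_ord_prime
    ord_prime_if_undirected_tree_order_divisor_graph
  by (auto simp: star_graph_def)

end


section \<open>The word problem of the dihedral group\<close>

text \<open>
  Words are evaluated in the infinite dihedral group of isometries
  \<open>x \<mapsto> i + x\<close> and \<open>x \<mapsto> i - x\<close> of the integers; the second component of \<open>(i, r)\<close> tells whether
  the isometry is a reflection.
\<close>

fun isometry :: "dihedral_gen word \<Rightarrow> int \<times> bool" where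
  "isometry [] = (0, False)"
| "isometry ((Gen_a, s) # w) = (fst (isometry w) + (if s then 1 else -1), snd (isometry w))"
| "isometry ((Gen_b, s) # w) = (- fst (isometry w), \<not> snd (isometry w))"

text \<open>For \<open>n > 0\<close>, translations by multiples of \<open>n\<close> are factored
  out, which leaves a concrete model of the dihedral group of order \<open>2 * n\<close>.\<close>

definition residue :: "nat \<Rightarrow> dihedral_gen word \<Rightarrow> int \<times> bool" where
  "residue n w = (fst (isometry w) mod int n, snd (isometry w))"

abbreviation rotation_word :: "nat \<Rightarrow> dihedral_gen word" where
  "rotation_word k \<equiv> replicate k (Gen_a, True)"

abbreviation dihedral_rel :: "nat \<Rightarrow> dihedral_gen word rel" where
  "dihedral_rel n \<equiv> pres_rel {rotation_word n, [(Gen_b, True), (Gen_b, True)],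
    [(Gen_a, True), (Gen_b, True), (Gen_a, True), (Gen_b, True)]}"

abbreviation dihedral_class :: "nat \<Rightarrow> dihedral_gen word \<Rightarrow> dihedral_gen word set" where
  "dihedral_class n w \<equiv> dihedral_rel n `` {w}"

section \<open>Invariance of residues under the defining relations\<close>

lemma isometry_append:
  "isometry (v @ w) =
    (fst (isometry v) + (if snd (isometry v) then - fst (isometry w) else fst (isometry w)),
     snd (isometry v) \<noteq> snd (isometry w))"
  by (induction v rule: isometry.induct) auto

lemma isometry_rotation_word [simp]: "isometry (rotation_word k) = (int k, False)"
  by (induction k) auto

lemma residue_append_cong:
  assumes "residue n v = residue n v'" "residue n w = residue n w'"
  shows "residue n (v @ w) = residue n (v' @ w')"
  using assms by (auto simp: residue_def isometry_append intro: mod_add_cong mod_diff_cong)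

text \<open>The relators act trivially: the first is translation by \<open>n\<close>, and b and ab
  are reflections, hence involutions. The congruence property reduces the claim to an empty left
  context.\<close>

lemma residue_eq_if_dihedral_rel:
  assumes "(v, w) \<in> dihedral_rel n"
  shows "residue n v = residue n w"
  using assms
proof (induction rule: pres_rel.induct)
  case (cancel u g s v)
  have "residue n ([(g, s), (g, \<not> s)] @ v) = residue n v"
    by (cases g) (simp_all add: residue_def)
  then show ?case
    by (rule residue_append_cong[OF HOL.refl])
next
  case (relator r u v)
  then have "residue n (r @ v) = residue n v"
    by (auto simp: residue_def isometry_append)
  then show ?case
    by (rule residue_append_cong[OF HOL.refl])
qed auto

section \<open>Reduction of words to normal form\<close>

lemma rotation_word_mult_rel: "(rotation_word (n * k) @ w, w) \<in> dihedral_rel n"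
proof (induction k)
  case 0
  show ?case by (simp add: pres_rel.refl)
next
  case (Suc k)
  have "(rotation_word n @ rotation_word (n * k) @ w, rotation_word (n * k) @ w) \<in> dihedral_rel n"
    using pres_rel.relator[of "rotation_word n" _ "[]"] by simp
  with Suc.IH show ?case
    by (auto simp: replicate_add intro: pres_rel.trans)
qed

lemma rotation_word_mod_rel: "(rotation_word k @ w, rotation_word (k mod n) @ w) \<in> dihedral_rel n"
  using rotation_word_mult_rel[where n = n and k = "k div n" and w = "rotation_word (k mod n) @ w"]
  by (simp flip: append_assoc replicate_add)

lemma cancel_Cons_rel: "((g, s) # (g, \<not> s) # w, w) \<in> pres_rel R"
  using pres_rel.cancel[of "[]" g s w R] by simp

text \<open>Insert the relator a^n behind the inverse of a and cancel one letter.\<close>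

lemma inverse_a_rel:
  assumes "n > 0"
  shows "((Gen_a, False) # w, rotation_word (n - 1) @ w) \<in> dihedral_rel n"
proof -
  have rotation: "rotation_word n = (Gen_a, True) # rotation_word (n - 1)"
    using assms by (cases n) auto
  have "([(Gen_a, False)] @ rotation_word n @ w, [(Gen_a, False)] @ w) \<in> dihedral_rel n"
    by (rule pres_rel.relator) simp
  from pres_rel.sym[OF this]
  have "((Gen_a, False) # w, (Gen_a, False) # (Gen_a, True) # rotation_word (n - 1) @ w)
      \<in> dihedral_rel n"
    by (simp add: rotation)
  then show ?thesis
    by (rule pres_rel.trans) (use cancel_Cons_rel[of Gen_a False] in simp)
qed

lemma inverse_b_rel: "((Gen_b, False) # w, (Gen_b, True) # w) \<in> dihedral_rel n"
proof -
  have "([(Gen_b, False)] @ [(Gen_b, True), (Gen_b, True)] @ w, [(Gen_b, False)] @ w)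
      \<in> dihedral_rel n"
    by (rule pres_rel.relator) simp
  from pres_rel.sym[OF this]
  have "((Gen_b, False) # w, (Gen_b, False) # (Gen_b, True) # (Gen_b, True) # w) \<in> dihedral_rel n"
    by simp
  then show ?thesis
    by (rule pres_rel.trans) (use cancel_Cons_rel[of Gen_b False] in simp)
qed

text \<open>Insert bb and then a^-1 a: ba = babb = a^-1 (abab) b = a^-1 b. The inverse of a is
  finally replaced by a^(n-1).\<close>

lemma b_a_rel:
  assumes "n > 0"
  shows "((Gen_b, True) # (Gen_a, True) # w, rotation_word (n - 1) @ (Gen_b, True) # w)
    \<in> dihedral_rel n"
proof -
  let ?a = "(Gen_a, True)" and ?b = "(Gen_b, True)"
  have "([?b, ?a] @ [?b, ?b] @ w, [?b, ?a] @ w) \<in> dihedral_rel n"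
    by (rule pres_rel.relator) simp
  from pres_rel.sym[OF this]
  have bb: "(?b # ?a # w, ?b # ?a # ?b # ?b # w) \<in> dihedral_rel n"
    by simp
  from pres_rel.sym[OF cancel_Cons_rel[of Gen_a False]]
  have aa: "(?b # ?a # ?b # ?b # w, (Gen_a, False) # ?a # ?b # ?a # ?b # ?b # w)
      \<in> dihedral_rel n"
    by simp
  have "([(Gen_a, False)] @ [?a, ?b, ?a, ?b] @ ?b # w, [(Gen_a, False)] @ ?b # w)
      \<in> dihedral_rel n"
    by (rule pres_rel.relator) simp
  then have abab: "((Gen_a, False) # ?a # ?b # ?a # ?b # ?b # w, (Gen_a, False) # ?b # w)
      \<in> dihedral_rel n"
    by simp
  show ?thesis
    by (rule pres_rel.trans[OF bb pres_rel.trans[OF aa pres_rel.trans[OF abab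
            inverse_a_rel[OF assms]]]])
qed

text \<open>Moving b past each a turns that a into a^(n-1). The exponent \<open>k * (n - 1)\<close>
  is congruent to -k modulo \<open>n\<close> but stays a natural number.\<close>

lemma b_rotation_word_rel:
  assumes "n > 0"
  shows "((Gen_b, True) # rotation_word k @ w, rotation_word (k * (n - 1)) @ (Gen_b, True) # w)
    \<in> dihedral_rel n"
proof (induction k)
  case 0
  show ?case by (simp add: pres_rel.refl)
next
  case (Suc k)
  have "(rotation_word (n - 1) @ (Gen_b, True) # rotation_word k @ w,
      rotation_word (n - 1) @ rotation_word (k * (n - 1)) @ (Gen_b, True) # w) \<in> dihedral_rel n"
    by (intro pres_rel_append pres_rel.refl Suc.IH)
  with b_a_rel[OF assms, of "rotation_word k @ w"] show ?case
    by (auto simp: replicate_add intro: pres_rel.trans)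
qed

text \<open>On pairs with first component in \<open>{0..<int n}\<close> this is a right inverse of
  \<open>residue n\<close>; \<open>nat\<close> loses nothing there.\<close>

fun normal_word :: "int \<times> bool \<Rightarrow> dihedral_gen word" where
  "normal_word (i, r) = rotation_word (nat i) @ (if r then [(Gen_b, True)] else [])"

lemma residue_normal_word:
  assumes "i \<in> {0..<int n}"
  shows "residue n (normal_word (i, r)) = (i, r)"
  using assms by (auto simp: residue_def isometry_append)

lemma normal_word_rel:
  assumes "n > 0"
  shows "(w, normal_word (residue n w)) \<in> dihedral_rel n"
proof -
  let ?b = "(Gen_b, True)"
  \<comment> \<open>The exponent stays unreduced during the induction; it only has to remain natural
    when a letter is put in front.\<close>
  have "\<exists>k r. (w, normal_word (int k, r)) \<in> dihedral_rel n"
  proof (induction w)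
    case Nil
    show ?case
      by (intro exI[of _ 0] exI[of _ False]) (simp add: pres_rel.refl)
  next
    case (Cons l w)
    then obtain k r where kr: "(w, normal_word (int k, r)) \<in> dihedral_rel n"
      by blast
    have lw: "(l # w, l # normal_word (int k, r)) \<in> dihedral_rel n" for l
      using pres_rel_append[OF pres_rel.refl[of "[l]"] kr] by simp
    \<comment> \<open>Shared by the cases b and b^-1, since the two letters are
      interchangeable.\<close>
    have b: "\<exists>k' r'. (?b # w, normal_word (int k', r')) \<in> dihedral_rel n"
    proof -
      let ?k = "k * (n - 1)"
      have "(?b # normal_word (int k, r), rotation_word ?k @ ?b # (if r then [?b] else []))
          \<in> dihedral_rel n"
        using b_rotation_word_rel[OF assms] by simp
      moreover have "(rotation_word ?k @ ?b # (if r then [?b] else []), normal_word (int ?k, \<not> r))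
          \<in> dihedral_rel n"
      proof (cases r)
        case True
        have "(rotation_word ?k @ [?b, ?b] @ [], rotation_word ?k @ []) \<in> dihedral_rel n"
          by (rule pres_rel.relator) simp
        with True show ?thesis by (simp del: of_nat_mult)
      qed (simp add: pres_rel.refl del: of_nat_mult)
      ultimately show ?thesis
        using lw by (blast intro: pres_rel.trans)
    qed
    obtain g s where l: "l = (g, s)" by (cases l)
    consider "l = (Gen_a, True)" | "l = (Gen_a, False)" | "l = ?b" | "l = (Gen_b, False)"
      using l by (cases g; cases s) auto
    then show ?case
    proof cases
      case 1
      then have "l # normal_word (int k, r) = normal_word (int (Suc k), r)"
        by (simp del: of_nat_Suc)
      then show ?thesis
        using lw by metis
    next
      case 2
      have "(rotation_word (n - 1) @ normal_word (int k, r)) = normal_word (int (n - 1 + k), r)"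
        by (simp add: replicate_add del: of_nat_add)
      then show ?thesis
        using lw inverse_a_rel[OF assms, of "normal_word (int k, r)"] unfolding 2
        by (metis pres_rel.trans)
    next
      case 3
      then show ?thesis using b by simp
    next
      case 4
      then show ?thesis using b inverse_b_rel by (blast intro: pres_rel.trans)
    qed
  qed
  then obtain k r where kr: "(w, normal_word (int k, r)) \<in> dihedral_rel n"
    by blast
  \<comment> \<open>Invariance of the residue identifies \<open>r\<close> and the exponent modulo
    \<open>n\<close>, so only the reduction of \<open>k\<close> remains.\<close>
  then have "residue n w = (int (k mod n), r)"
    by (auto dest!: residue_eq_if_dihedral_rel simp: residue_def isometry_append zmod_int split: if_splits)
  then show ?thesis
    using pres_rel.trans[OF kr] rotation_word_mod_rel by simp
qed

text \<open>Words with equal residues are related to the same normal word; the converse is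
  invariance.\<close>

lemma dihedral_class_eq_iff:
  assumes "n > 0"
  shows "dihedral_class n v = dihedral_class n w \<longleftrightarrow> residue n v = residue n w"
proof -
  have "(v, w) \<in> dihedral_rel n" if "residue n v = residue n w"
    using that normal_word_rel[OF assms] by (metis pres_rel.sym pres_rel.trans)
  then show ?thesis
    using residue_eq_if_dihedral_rel by (auto simp: eq_equiv_class_iff[OF equiv_pres_rel])
qed


section \<open>Orders in the dihedral group\<close>

lemma dihedral_group_eq:
  "dihedral_group n = presented_group {rotation_word n, [(Gen_b, True), (Gen_b, True)],
    [(Gen_a, True), (Gen_b, True), (Gen_a, True), (Gen_b, True)]}"
  by (simp add: dihedral_group_def Let_def)

lemma carrier_dihedral_group: "carrier (dihedral_group n) = range (dihedral_class n)"
  by (auto simp: dihedral_group_eq presented_group_def quotient_def)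

lemma one_dihedral_group: "\<one>\<^bsub>dihedral_group n\<^esub> = dihedral_class n []"
  by (simp add: dihedral_group_eq presented_group_def)

lemma pow_dihedral_class:
  "dihedral_class n w [^]\<^bsub>dihedral_group n\<^esub> (k::nat) = dihedral_class n (concat (replicate k w))"
proof (induction k)
  case 0
  show ?case by (simp add: one_dihedral_group)
next
  case (Suc k)
  have "concat (replicate k w) @ w = concat (replicate (Suc k) w)"
    by (induction k) auto
  with Suc show ?case
    by (simp add: dihedral_group_eq mult_presented_group)
qed

text \<open>The normal words of the \<open>2 * n\<close> possible residues represent each class
  exactly once.\<close>

lemma order_dihedral_group:
  assumes "n > 0"
  shows "order (dihedral_group n) = 2 * n"
proof -
  let ?A = "{0..<int n} \<times> (UNIV :: bool set)"
  have "bij_betw (\<lambda>x. dihedral_class n (normal_word x)) ?A (carrier (dihedral_group n))"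
  proof (rule bij_betwI')
    fix x y assume "x \<in> ?A" "y \<in> ?A"
    then show "dihedral_class n (normal_word x) = dihedral_class n (normal_word y) \<longleftrightarrow> x = y"
      unfolding dihedral_class_eq_iff[OF assms]
      by (cases x; cases y) (auto simp: residue_normal_word simp del: normal_word.simps)
  next
    fix X assume "X \<in> carrier (dihedral_group n)"
    then obtain w where "X = dihedral_class n w"
      by (auto simp: carrier_dihedral_group)
    moreover have "residue n w \<in> ?A"
      using assms by (simp add: residue_def)
    ultimately show "\<exists>x\<in>?A. X = dihedral_class n (normal_word x)"
      using equiv_class_eq[OF equiv_pres_rel normal_word_rel[OF assms, of w]] by metis
  qed (simp add: carrier_dihedral_group)
  then have "card ?A = order (dihedral_group n)"
    unfolding order_def by (rule bij_betw_same_card)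
  then show ?thesis
    by (simp add: card_cartesian_product)
qed

lemma isometry_concat_replicate:
  assumes "\<not> snd (isometry w)"
  shows "isometry (concat (replicate k w)) = (int k * fst (isometry w), False)"
  using assms by (induction k) (auto simp: isometry_append algebra_simps)

text \<open>A reflection is an involution, and the n-th power of a translation by i is translation
  by ni, which is 0 modulo \<open>n\<close>.\<close>

lemma ord_dihedral_class_dvd:
  assumes "n > 0"
  shows "group.ord (dihedral_group n) (dihedral_class n w) dvd
    (if snd (isometry w) then 2 else n)"
proof -
  interpret group "dihedral_group n"
    by (rule group_dihedral_group)
  have "dihedral_class n w [^]\<^bsub>dihedral_group n\<^esub> (if snd (isometry w) then 2 else n) =
      \<one>\<^bsub>dihedral_group n\<^esub>"
    unfolding pow_dihedral_class one_dihedral_group dihedral_class_eq_iff[OF assms]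
    by (auto simp: residue_def isometry_concat_replicate isometry_append numeral_2_eq_2)
  then show ?thesis
    by (simp add: carrier_dihedral_group flip: pow_eq_id)
qed

text \<open>The k-th power of a has residue k modulo \<open>n\<close>, which vanishes exactly when
  \<open>n\<close> divides k.\<close>

lemma ord_rotation:
  assumes "n > 0"
  shows "group.ord (dihedral_group n) (dihedral_class n (rotation_word 1)) = n"
proof -
  interpret group "dihedral_group n"
    by (rule group_dihedral_group)
  have a: "dihedral_class n (rotation_word 1) \<in> carrier (dihedral_group n)"
    by (simp add: carrier_dihedral_group)
  show ?thesis
    unfolding ord_unique[OF a] pow_dihedral_class one_dihedral_group dihedral_class_eq_iff[OF assms]
    by (auto simp: residue_def isometry_concat_replicate simp flip: zmod_int)
qed

theorem theorem2:
  fixes n :: nat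
  assumes "n \<ge> 3"
  shows "star_graph (2 * n) (with_proj (order_divisor_graph (dihedral_group n))) \<longleftrightarrow>
    Factorial_Ring.prime n"
proof -
  interpret group "dihedral_group n"
    by (rule group_dihedral_group)
  have n: "n > 0"
    using assms by simp
  have fin: "finite (carrier (dihedral_group n))"
    using order_dihedral_group[OF n] n by (simp flip: order_gt_0_iff_finite)
  have "(\<forall>x\<in>carrier (dihedral_group n) - {\<one>\<^bsub>dihedral_group n\<^esub>}. Factorial_Ring.prime (ord x))
      \<longleftrightarrow> Factorial_Ring.prime n"
  proof
    let ?a = "dihedral_class n (rotation_word 1)"
    assume ord_prime: "\<forall>x\<in>carrier (dihedral_group n) - {\<one>\<^bsub>dihedral_group n\<^esub>}.
      Factorial_Ring.prime (ord x)"
    have ord_a: "ord ?a = n"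
      by (rule ord_rotation[OF n])
    have "?a \<noteq> \<one>\<^bsub>dihedral_group n\<^esub>"
    proof
      assume "?a = \<one>\<^bsub>dihedral_group n\<^esub>"
      then have "ord ?a = 1"
        by (simp only: ord_id)
      then show False
        using ord_a assms by linarith
    qed
    moreover have "?a \<in> carrier (dihedral_group n)"
      unfolding carrier_dihedral_group by (rule rangeI)
    ultimately have "Factorial_Ring.prime (ord ?a)"
      using ord_prime by blast
    then show "Factorial_Ring.prime n"
      unfolding ord_a .
  next
    assume prime: "Factorial_Ring.prime n"
    show "\<forall>x\<in>carrier (dihedral_group n) - {\<one>\<^bsub>dihedral_group n\<^esub>}. Factorial_Ring.prime (ord x)"
    proof
      fix x assume x: "x \<in> carrier (dihedral_group n) - {\<one>\<^bsub>dihedral_group n\<^esub>}"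
      then obtain w where "x = dihedral_class n w"
        by (auto simp: carrier_dihedral_group)
      then have "ord x dvd 2 \<or> ord x dvd n"
        using ord_dihedral_class_dvd[OF n, of w] by (simp split: if_splits)
      moreover have "ord x \<noteq> 1"
        using x ord_eq_1 by blast
      \<comment> \<open>A divisor other than 1 of one of the primes 2 and \<open>n\<close> is that
        prime.\<close>
      ultimately show "Factorial_Ring.prime (ord x)"
        using prime two_is_prime_nat by (metis prime_nat_iff)
    qed
  qed
  then show ?thesis
    using star_graph_order_divisor_graph_iff[OF fin] order_dihedral_group[OF n] by simp
qed

end
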